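(* Let $A$ be the adjacency matrix of a Paley type strongly regular graph with parameters $(v,k,\lambda,\lambda+1)$. Fix a row of $A$ and let $R$ denote its support. Let $\mathcal{B}=\{R\cap S\mid S\ (\neq R)\text{ is the support of a row of }A\}$, and let $\mathcal{B}_\infty$ be the collection consisting of all members of $\mathcal{B}$ of size $\lambda+1$, together with all members of $\mathcal{B}$ of size $\lambda$ each modified by adjoining a new point $\infty$. Then $(R\cup\{\infty\},\mathcal{B}_\infty)$ is a $2$-$(k+1,\lambda+1,\lambda-1)$ adesign.
   Context: A strongly regular graph with parameters $(v,k,\lambda,\mu)$ is a graph on $v$ vertices, regular of degree $k$, in which any two adjacent vertices have exactly $\lambda$ common neighbours and any two distinct non-adjacent vertices have exactly $\mu$ common neighbours. It is of Paley type if, up to complementation, its parameters are $(v,\frac{v-1}{2},\frac{v-5}{4},\frac{v-1}{4})$. A $2$-$(v,k,\lambda)$ adesign is an incidence structure with $v$ points and all blocks of size $k$, in which every pair of distinct points lies in either $\lambda$ or $\lambda+1$ blocks for a positive integer $\lambda$, and which is not a $2$-design (i.e., not every pair lies in the same number of blocks).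
   Formalization: The formal theorem assumes λ ≥ 2: for λ = 0 (v = 5) and λ = 1 (v = 9) the index λ−1 would be −1 or 0, while an adesign must have a positive index, so the claim fails there. *)

theory Defs
  imports "Graph_Theory.Pair_Digraph" "Jordan_Normal_Form.Matrix"
begin

(* A finite simple graph is a loop-free symmetric digraph: pair_graph of Graph_Theory. *)

definition neighbours :: "'a pair_pre_digraph \<Rightarrow> 'a \<Rightarrow> 'a set" where
  "neighbours G u = {w. (u, w) \<in> parcs G}"

definition complement_graph :: "'a pair_pre_digraph \<Rightarrow> 'a pair_pre_digraph" where
  "complement_graph G =
     \<lparr> pverts = pverts G,
       parcs = {(u, w). u \<in> pverts G \<and> w \<in> pverts G \<and> u \<noteq> w \<and> (u, w) \<notin> parcs G} \<rparr>"

definition strongly_regular ::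
  "'a pair_pre_digraph \<Rightarrow> nat \<Rightarrow> nat \<Rightarrow> nat \<Rightarrow> nat \<Rightarrow> bool" where
  "strongly_regular G v k l m \<longleftrightarrow>
     pair_graph G \<and> card (pverts G) = v \<and>
     (\<forall>u \<in> pverts G. card (neighbours G u) = k) \<and>
     (\<forall>u \<in> pverts G. \<forall>w \<in> pverts G. (u, w) \<in> parcs G \<longrightarrow>
        card (neighbours G u \<inter> neighbours G w) = l) \<and>
     (\<forall>u \<in> pverts G. \<forall>w \<in> pverts G. u \<noteq> w \<and> (u, w) \<notin> parcs G \<longrightarrow>
        card (neighbours G u \<inter> neighbours G w) = m)"

(* The equations are over the reals, so that neither truncated subtraction nor rounding
   division admits spurious parameters. *)
definition has_paley_parameters :: "'a pair_pre_digraph \<Rightarrow> bool" where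
  "has_paley_parameters G \<longleftrightarrow>
     (\<exists>v k l m. strongly_regular G v k l m \<and>
        real k = (real v - 1) / 2 \<and> real l = (real v - 5) / 4 \<and> real m = (real v - 1) / 4)"

definition paley_type :: "'a pair_pre_digraph \<Rightarrow> bool" where
  "paley_type G \<longleftrightarrow> has_paley_parameters G \<or> has_paley_parameters (complement_graph G)"

(* The bijection f is the ordering of the vertices that labels the rows and columns. *)
definition is_adjacency_matrix ::
  "'a pair_pre_digraph \<Rightarrow> 'b :: zero_neq_one mat \<Rightarrow> bool" where
  "is_adjacency_matrix G A \<longleftrightarrow>
     (\<exists>f. bij_betw f {..<card (pverts G)} (pverts G) \<and>
          A = mat (card (pverts G)) (card (pverts G))
                (\<lambda>(i, j). if (f i, f j) \<in> parcs G then 1 else 0))"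

definition vec_support :: "'b :: zero vec \<Rightarrow> nat set" where
  "vec_support x = {j. j < dim_vec x \<and> x $ j \<noteq> 0}"

(* An incidence structure is given by its points P, its blocks B and the incidence
   relation I; distinct elements of B may be incident with the same points. *)
definition incidence_structure :: "'p set \<Rightarrow> 'b set \<Rightarrow> ('p \<times> 'b) set \<Rightarrow> bool" where
  "incidence_structure P B I \<longleftrightarrow> finite P \<and> finite B \<and> I \<subseteq> P \<times> B"

definition membership_incidence :: "'p set set \<Rightarrow> ('p \<times> 'p set) set" where
  "membership_incidence B = {(p, b). b \<in> B \<and> p \<in> b}"

definition joint_blocks :: "'b set \<Rightarrow> ('p \<times> 'b) set \<Rightarrow> 'p \<Rightarrow> 'p \<Rightarrow> nat" where
  "joint_blocks B I p q = card {b \<in> B. (p, b) \<in> I \<and> (q, b) \<in> I}"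

definition is_2_design ::
  "'p set \<Rightarrow> 'b set \<Rightarrow> ('p \<times> 'b) set \<Rightarrow> nat \<Rightarrow> nat \<Rightarrow> nat \<Rightarrow> bool" where
  "is_2_design P B I v k l \<longleftrightarrow>
     incidence_structure P B I \<and> card P = v \<and>
     (\<forall>b \<in> B. card {p \<in> P. (p, b) \<in> I} = k) \<and>
     (\<forall>p \<in> P. \<forall>q \<in> P. p \<noteq> q \<longrightarrow> joint_blocks B I p q = l)"

definition is_2_adesign ::
  "'p set \<Rightarrow> 'b set \<Rightarrow> ('p \<times> 'b) set \<Rightarrow> nat \<Rightarrow> nat \<Rightarrow> nat \<Rightarrow> bool" where
  "is_2_adesign P B I v k l \<longleftrightarrow>
     incidence_structure P B I \<and> card P = v \<and>
     (\<forall>b \<in> B. card {p \<in> P. (p, b) \<in> I} = k) \<and>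
     0 < l \<and>
     (\<forall>p \<in> P. \<forall>q \<in> P. p \<noteq> q \<longrightarrow> joint_blocks B I p q \<in> {l, l + 1}) \<and>
     \<not> (\<exists>l'. is_2_design P B I v k l')"

definition row_intersections :: "'b :: zero mat \<Rightarrow> nat set \<Rightarrow> nat set set" where
  "row_intersections A R =
     {R \<inter> S | S. (\<exists>j < dim_row A. S = vec_support (row A j)) \<and> S \<noteq> R}"

(* The point at infinity is None; an original point j becomes Some j. *)
definition extended_points :: "nat set \<Rightarrow> nat option set" where
  "extended_points R = insert None (Some ` R)"

definition extended_blocks :: "nat set set \<Rightarrow> nat \<Rightarrow> nat option set set" where
  "extended_blocks B l =
     {Some ` b | b. b \<in> B \<and> card b = l + 1} \<union>
     {insert None (Some ` b) | b. b \<in> B \<and> card b = l}"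

end

theory Submission
  imports Defs
begin

(* Counting paths of length two from a fixed vertex turns v - 1 = 2k into k = 2m and v = 4m + 1
   with m = l + 1. The blocks are indexed by the vertices y other than the fixed vertex x. Two
   points of R = N(x) lie in one block less than the number of their common neighbours, and a
   point of R lies with infinity in l blocks; both numbers are l - 1 or l, and both values occur.

   Since the blocks form a set, it remains to see that distinct vertices y, z give distinct
   blocks. If N(x) \<inter> N(y) = N(x) \<inter> N(z) with y, z not adjacent to x, then x, y, z are
   pairwise non-adjacent with the same common neighbours, which takes 4m + 3 vertices. If y, z are
   adjacent to x, then N(x), N(y), N(z) cover all vertices, and inclusion-exclusion for the
   neighbourhood of w gives that m is even if w is adjacent to all of x, y, z and that m is odd
   if w is adjacent to y only; vertices of both kinds exist. *)

section \<open>Conference graphs and the traces of neighbourhoods on a fixed one\<close>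

text \<open>Only neighbourhoods enter, so that vertices can later be matrix indices and
  \<open>N\<close> the row supports. Writing \<open>common_adj\<close> with \<open>+ 1\<close>
  rather than with a truncated \<open>m - 1\<close> keeps the equations linear.\<close>

locale conference_graph =
  fixes V :: "'c set" and N :: "'c \<Rightarrow> 'c set" and m :: nat
  assumes finite_V: "finite V"
    and card_V: "card V = 4 * m + 1"
    and N_subset: "x \<in> V \<Longrightarrow> N x \<subseteq> V"
    and N_irrefl: "x \<in> V \<Longrightarrow> x \<notin> N x"
    and N_sym: "\<lbrakk>x \<in> V; y \<in> N x\<rbrakk> \<Longrightarrow> x \<in> N y"
    and card_N: "x \<in> V \<Longrightarrow> card (N x) = 2 * m"
    and common_adj: "\<lbrakk>x \<in> V; y \<in> N x\<rbrakk> \<Longrightarrow> card (N x \<inter> N y) + 1 = m"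
    and common_nonadj: "\<lbrakk>x \<in> V; y \<in> V; x \<noteq> y; y \<notin> N x\<rbrakk> \<Longrightarrow> card (N x \<inter> N y) = m"
begin

lemma finite_N: "x \<in> V \<Longrightarrow> finite (N x)"
  using N_subset finite_V finite_subset by blast

lemma inj_trace_nonadj:
  assumes x: "x \<in> V" and y: "y \<in> V" "y \<noteq> x" "y \<notin> N x" and z: "z \<in> V" "z \<noteq> x" "z \<notin> N x"
    and eq: "N x \<inter> N y = N x \<inter> N z"
  shows "y = z"
proof (rule ccontr)
  assume yz: "y \<noteq> z"
  note fin = finite_N[OF x] finite_N[OF y(1)] finite_N[OF z(1)]
  have cxy: "card (N x \<inter> N y) = m"
    using common_nonadj[of x y] x y by auto
  have sub: "N x \<inter> N y \<subseteq> N y \<inter> N z"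
    using eq by blast
  then have "m \<le> card (N y \<inter> N z)"
    using cxy fin by (metis card_mono finite_Int)
  \<comment> \<open>Adjacent \<open>y\<close> and \<open>z\<close> would share only m - 1
    neighbours.\<close>
  then have zy: "z \<notin> N y"
    using common_adj[of y z] y by auto
  then have cyz: "card (N y \<inter> N z) = m"
    using common_nonadj[of y z] y z yz by auto
  \<comment> \<open>Equal cardinality turns the inclusion into equality: the three pairwise
    intersections are one m-set, and the union of the neighbourhoods has 6m - 2m elements.\<close>
  then have T: "N y \<inter> N z = N x \<inter> N y"
    using card_subset_eq[OF _ sub] cxy fin by auto
  have "card (N x) + card (N y) = card (N x \<union> N y) + card (N x \<inter> N y)"
    using fin by (intro card_Un_Int) auto
  moreover have "card (N x \<union> N y) + card (N z)
      = card (N x \<union> N y \<union> N z) + card ((N x \<union> N y) \<inter> N z)"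
    using fin by (intro card_Un_Int) auto
  moreover have "(N x \<union> N y) \<inter> N z = N x \<inter> N y"
    using T eq by blast
  ultimately have "card (N x \<union> N y \<union> N z) = 4 * m"
    using card_N x y z cxy by auto
  moreover have "card ({x, y, z} \<union> (N x \<union> N y \<union> N z)) = card {x, y, z} + card (N x \<union> N y \<union> N z)"
    using fin x y z zy N_irrefl N_sym
    by (intro card_Un_disjoint) blast+
  moreover have "card {x, y, z} = 3"
    using y z yz by auto
  moreover have "card ({x, y, z} \<union> (N x \<union> N y \<union> N z)) \<le> card V"
    using x y z N_subset by (intro card_mono finite_V) blast
  ultimately show False
    using card_V by linarith
qed

lemma inj_trace_adj:
  assumes x: "x \<in> V" and y: "y \<in> N x" and z: "z \<in> N x"
    and eq: "N x \<inter> N y = N x \<inter> N z" and m: "m \<ge> 2"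
  shows "y = z"
proof (rule ccontr)
  assume yz: "y \<noteq> z"
  have V: "y \<in> V" "z \<in> V"
    using x y z N_subset by blast+
  note fin = finite_N[OF x] finite_N[OF V(1)] finite_N[OF V(2)]
  define T where "T = N x \<inter> N y"
  have cT: "card T + 1 = m"
    unfolding T_def using common_adj x y by blast
  have finT: "finite T"
    unfolding T_def using fin by blast
  have xT: "x \<notin> T"
    unfolding T_def using N_irrefl x by blast
  \<comment> \<open>If \<open>z\<close> were in \<open>N y\<close>, it would lie in
    \<open>N x \<inter> N y = N x \<inter> N z\<close>, hence in \<open>N z\<close>.\<close>
  have zy: "z \<notin> N y"
    using eq z N_irrefl[OF V(2)] by blast
  have "card (N y \<inter> N z) = m"
    using common_nonadj[of y z] V yz zy by blast
  moreover have "card (insert x T) = m"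
    using cT xT finT by simp
  moreover have "insert x T \<subseteq> N y \<inter> N z"
    using T_def eq N_sym x y z by blast
  ultimately have cyz: "N y \<inter> N z = insert x T"
    using card_subset_eq fin by (metis finite_Int)
  have "card (N x) + card (N y) = card (N x \<union> N y) + card T"
    unfolding T_def using fin by (intro card_Un_Int) auto
  moreover have "card (N x \<union> N y) + card (N z)
      = card (N x \<union> N y \<union> N z) + card ((N x \<union> N y) \<inter> N z)"
    using fin by (intro card_Un_Int) auto
  moreover have "(N x \<union> N y) \<inter> N z = insert x T"
    using cyz eq T_def by blast
  \<comment> \<open>The sizes give 2m + 2m - (m - 1) = 3m + 1, then 3m + 1 + 2m - m = 4m +
    1.\<close>
  ultimately have "card (N x \<union> N y \<union> N z) = card V"
    using card_N x V cT card_V finT xT by auto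
  then have cover: "N x \<union> N y \<union> N z = V"
    using card_subset_eq[OF finite_V, of "N x \<union> N y \<union> N z"] N_subset x V by blast
  \<comment> \<open>Inclusion-exclusion inside \<open>N w\<close>, with overlaps \<open>T\<close>
    and then \<open>insert x T\<close>. The last summand is 1 or 0 according to whether
    \<open>w\<close> is adjacent to \<open>x\<close>; it decides the parity below.\<close>
  have count: "card (N w \<inter> N x) + card (N w \<inter> N y) + card (N w \<inter> N z)
      = 2 * m + 2 * card (N w \<inter> T) + card (N w \<inter> {x})" if w: "w \<in> V" for w
  proof -
    have finw: "finite (N w)"
      using finite_N w by blast
    have "card (N w \<inter> N x) + card (N w \<inter> N y)
        = card (N w \<inter> (N x \<union> N y)) + card (N w \<inter> T)"
    proof -
      have "N w \<inter> N x \<inter> (N w \<inter> N y) = N w \<inter> T" "N w \<inter> N x \<union> N w \<inter> N y = N w \<inter> (N x \<union> N y)"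
        unfolding T_def by blast+
      then show ?thesis
        using card_Un_Int[of "N w \<inter> N x" "N w \<inter> N y"] finw by simp
    qed
    moreover have "card (N w \<inter> (N x \<union> N y)) + card (N w \<inter> N z)
        = card (N w) + (card (N w \<inter> T) + card (N w \<inter> {x}))"
    proof -
      have "N w \<inter> (N x \<union> N y) \<union> N w \<inter> N z = N w"
        using cover N_subset[OF w] by blast
      moreover have "N w \<inter> (N x \<union> N y) \<inter> (N w \<inter> N z) = N w \<inter> T \<union> N w \<inter> {x}"
        using cyz eq T_def by blast
      moreover have "card (N w \<inter> T \<union> N w \<inter> {x}) = card (N w \<inter> T) + card (N w \<inter> {x})"
        using finw xT by (intro card_Un_disjoint) auto
      ultimately show ?thesis
        using card_Un_Int[of "N w \<inter> (N x \<union> N y)" "N w \<inter> N z"] finw by simp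
    qed
    ultimately show ?thesis
      using card_N[OF w] by simp
  qed
  have "T \<noteq> {}"
    using cT m by auto
  then obtain t where t: "t \<in> T"
    by blast
  have tV: "t \<in> V" and tN: "x \<in> N t" "y \<in> N t" "z \<in> N t"
    using t eq x V N_subset N_sym unfolding T_def by blast+
  then have "N t \<inter> {x} = {x}"
    by blast
  \<comment> \<open>Each of the three terms on the left of \<open>count\<close> is m - 1, and
    \<open>x\<close> contributes 1 on the right.\<close>
  then have "2 * m + 2 * card (N t \<inter> T) + 1 + 3 = 3 * m"
    using count[OF tV] common_adj[OF tV tN(1)] common_adj[OF tV tN(2)] common_adj[OF tV tN(3)]
    by simp
  then have "even m"
    by presburger
  have "card (insert x T) < card (N y)"
    using card_N V cT xT finT m by simp
  \<comment> \<open>Both \<open>N x \<inter> N y\<close> and \<open>N y \<inter> N z\<close> lie in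
    \<open>insert x T\<close>, so a neighbour \<open>u\<close> of \<open>y\<close> outside that set
    is adjacent to neither \<open>x\<close> nor \<open>z\<close>.\<close>
  then obtain u where u: "u \<in> N y" "u \<notin> insert x T"
    using card_mono[of "insert x T" "N y"] finT by (meson finite_insert leD subsetI)
  have uV: "u \<in> V" and uN: "y \<in> N u"
    using u V N_subset N_sym by blast+
  have un: "x \<notin> N u" "z \<notin> N u"
    using N_sym[OF uV] u cyz T_def by blast+
  have ne: "u \<noteq> x" "u \<noteq> z"
    using u zy by blast+
  have "N u \<inter> {x} = {}"
    using un by blast
  \<comment> \<open>The left of \<open>count\<close> is now m + (m - 1) + m, and \<open>x\<close>
    contributes 0 on the right.\<close>
  then have "2 * m + 2 * card (N u \<inter> T) + 1 = 3 * m"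
    using count[OF uV] common_nonadj[OF uV x ne(1) un(1)] common_adj[OF uV uN]
      common_nonadj[OF uV V(2) ne(2) un(2)]
    by simp
  then have "odd m"
    by presburger
  with \<open>even m\<close> show False
    by simp
qed

section \<open>The extended blocks and their adesign\<close>

text \<open>Infinity is adjoined by adjacency instead of by the size of the trace. For
  \<open>y\<close> in \<open>V - {x}\<close> the two criteria agree, because the trace has m - 1
  elements exactly when \<open>y\<close> is adjacent to \<open>x\<close>.\<close>

definition ext_block :: "'c \<Rightarrow> 'c \<Rightarrow> 'c option set" where
  "ext_block x y = Some ` (N x \<inter> N y) \<union> (if y \<in> N x then {None} else {})"

lemma Some_in_ext_block: "Some p \<in> ext_block x y \<longleftrightarrow> p \<in> N x \<and> p \<in> N y"
  by (auto simp: ext_block_def)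

lemma None_in_ext_block: "None \<in> ext_block x y \<longleftrightarrow> y \<in> N x"
  by (auto simp: ext_block_def)

text \<open>The point \<open>None\<close> records adjacency to \<open>x\<close>, so equal blocks
  come from two neighbours or two non-neighbours of \<open>x\<close>, and each case has its own
  trace lemma.\<close>

lemma inj_on_ext_block:
  assumes x: "x \<in> V" and m: "m \<ge> 2"
  shows "inj_on (ext_block x) (V - {x})"
proof (rule inj_onI)
  fix y z
  assume y: "y \<in> V - {x}" and z: "z \<in> V - {x}" and eq: "ext_block x y = ext_block x z"
  have "y \<in> N x \<longleftrightarrow> z \<in> N x"
    using eq None_in_ext_block by metis
  moreover have "N x \<inter> N y = N x \<inter> N z"
    using eq Some_in_ext_block by blast
  ultimately show "y = z"
    using inj_trace_adj[OF x _ _ _ m, of y z] inj_trace_nonadj[OF x, of y z] y z by blast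
qed

lemma card_ext_block:
  assumes x: "x \<in> V" and y: "y \<in> V" "y \<noteq> x"
  shows "card (ext_block x y) = m"
proof -
  have "card (Some ` (N x \<inter> N y)) = card (N x \<inter> N y)"
    by (simp add: card_image)
  moreover have "finite (Some ` (N x \<inter> N y))"
    using finite_N[OF x] by simp
  ultimately show ?thesis
    using common_adj[OF x, of y] common_nonadj[OF x, of y] y by (auto simp: ext_block_def)
qed

text \<open>Injectivity ensures that no blocks collapse in the set \<open>B\<close>, so counting
  blocks becomes counting vertices.\<close>

lemma joint_blocks_ext_block:
  assumes x: "x \<in> V" and m: "m \<ge> 2"
  defines "B \<equiv> ext_block x ` (V - {x})"
  shows "joint_blocks B (membership_incidence B) p q
    = card {y \<in> V - {x}. p \<in> ext_block x y \<and> q \<in> ext_block x y}"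
proof -
  have "{b \<in> B. (p, b) \<in> membership_incidence B \<and> (q, b) \<in> membership_incidence B}
      = ext_block x ` {y \<in> V - {x}. p \<in> ext_block x y \<and> q \<in> ext_block x y}"
    unfolding B_def membership_incidence_def by auto
  moreover have "inj_on (ext_block x) {y \<in> V - {x}. p \<in> ext_block x y \<and> q \<in> ext_block x y}"
    by (rule inj_on_subset[OF inj_on_ext_block[OF x m]]) blast
  ultimately show ?thesis
    unfolding joint_blocks_def by (simp add: card_image)
qed

lemma joint_blocks_Some_Some:
  assumes x: "x \<in> V" and m: "m \<ge> 2" and p: "p \<in> N x" and q: "q \<in> N x"
  defines "B \<equiv> ext_block x ` (V - {x})"
  shows "joint_blocks B (membership_incidence B) (Some p) (Some q) = card (N p \<inter> N q) - 1"
proof -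
  have V: "p \<in> V" "q \<in> V"
    using N_subset x p q by blast+
  then have "{y \<in> V - {x}. Some p \<in> ext_block x y \<and> Some q \<in> ext_block x y} = N p \<inter> N q - {x}"
    using N_sym N_subset p q unfolding Some_in_ext_block by blast
  \<comment> \<open>The vertex \<open>x\<close> is a common neighbour that indexes no block; this is
    the source of the subtracted 1.\<close>
  moreover have "x \<in> N p \<inter> N q"
    using N_sym x p q by blast
  ultimately show ?thesis
    unfolding B_def joint_blocks_ext_block[OF x m] by (simp add: card_Diff_singleton)
qed

text \<open>Blocks through infinity are indexed by the neighbours of \<open>x\<close>, and those
  also through \<open>p\<close> by the common neighbours of \<open>x\<close> and
  \<open>p\<close>.\<close>

lemma joint_blocks_Some_None:
  assumes x: "x \<in> V" and m: "m \<ge> 2" and p: "p \<in> N x"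
  defines "B \<equiv> ext_block x ` (V - {x})"
  shows "joint_blocks B (membership_incidence B) (Some p) None = m - 1"
proof -
  have V: "p \<in> V"
    using N_subset x p by blast
  then have "{y \<in> V - {x}. Some p \<in> ext_block x y \<and> None \<in> ext_block x y} = N x \<inter> N p"
    using N_sym N_subset N_irrefl x p unfolding Some_in_ext_block None_in_ext_block by blast
  then show ?thesis
    unfolding B_def joint_blocks_ext_block[OF x m] using common_adj[OF x p] by simp
qed

lemma joint_blocks_commute: "joint_blocks B I p q = joint_blocks B I q p"
  unfolding joint_blocks_def by (simp add: conj_commute)

lemma is_2_adesign_ext_block:
  assumes x: "x \<in> V" and m: "m \<ge> 3"
  defines "B \<equiv> ext_block x ` (V - {x})" and "P \<equiv> insert None (Some ` N x)"
  shows "is_2_adesign P B (membership_incidence B) (2 * m + 1) m (m - 2)"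
proof -
  have m2: "m \<ge> 2"
    using m by simp
  note SS = joint_blocks_Some_Some[OF x m2, folded B_def]
  note SN = joint_blocks_Some_None[OF x m2, folded B_def]
  have block: "{p \<in> P. (p, b) \<in> membership_incidence B} = b" if "b \<in> B" for b
    using that unfolding P_def B_def membership_incidence_def ext_block_def
    by (auto split: if_splits)
  have inc: "incidence_structure P B (membership_incidence B)"
    unfolding incidence_structure_def
  proof (intro conjI)
    show "finite P" "finite B"
      unfolding P_def B_def using finite_N[OF x] finite_V by auto
    show "membership_incidence B \<subseteq> P \<times> B"
      using block unfolding membership_incidence_def by auto
  qed
  have cardP: "card P = 2 * m + 1"
  proof -
    have "card (Some ` N x) = 2 * m" "finite (Some ` N x)" "None \<notin> Some ` N x"
      using card_N[OF x] finite_N[OF x] by (auto simp: card_image)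
    then show ?thesis
      unfolding P_def by simp
  qed
  have size: "\<forall>b \<in> B. card {p \<in> P. (p, b) \<in> membership_incidence B} = m"
    using block card_ext_block[OF x] by (auto simp: B_def)
  have pairs: "joint_blocks B (membership_incidence B) p q \<in> {m - 2, m - 2 + 1}"
    if pq: "p \<in> P" "q \<in> P" "p \<noteq> q" for p q
  proof -
    have SS': "joint_blocks B (membership_incidence B) (Some a) (Some b) \<in> {m - 2, m - 2 + 1}"
      if "a \<in> N x" "b \<in> N x" "a \<noteq> b" for a b
    proof -
      have "a \<in> V" "b \<in> V"
        using that N_subset x by blast+
      \<comment> \<open>Adjacent points lie in m - 2 common blocks, non-adjacent ones in m -
        1.\<close>
      then have "card (N a \<inter> N b) + 1 = m \<or> card (N a \<inter> N b) = m"
        using common_adj common_nonadj that by blast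
      then show ?thesis
        using SS[OF that(1,2)] m by auto
    qed
    have "m - 1 = m - 2 + 1"
      using m by simp
    then show ?thesis
      using pq SS' SN unfolding P_def
      by (auto simp: joint_blocks_commute[of _ _ None])
  qed
  have "\<not> is_2_design P B (membership_incidence B) (2 * m + 1) m l" for l
  proof
    assume des: "is_2_design P B (membership_incidence B) (2 * m + 1) m l"
    have "card (N x) \<noteq> 0"
      using card_N[OF x] m by simp
    \<comment> \<open>Two adjacent points \<open>p\<close>, \<open>q\<close> of \<open>N x\<close>
      share m - 2 blocks, while \<open>p\<close> and infinity share m - 1, so the count is not
      constant.\<close>
    then obtain p where p: "p \<in> N x"
      by fastforce
    then have "card (N x \<inter> N p) \<noteq> 0"
      using common_adj[OF x p] m by simp
    then obtain q where q: "q \<in> N x" "q \<in> N p"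
      by (metis Int_iff card.empty equals0I)
    have pV: "p \<in> V"
      using p N_subset x by blast
    have ne: "p \<noteq> q"
      using q N_irrefl[OF pV] by blast
    have "joint_blocks B (membership_incidence B) (Some p) (Some q) = l"
      "joint_blocks B (membership_incidence B) (Some p) None = l"
      using des p q ne unfolding is_2_design_def P_def by auto
    then show False
      using SS[OF p q(1)] SN[OF p] common_adj[OF pV q(2)] m by simp
  qed
  then show ?thesis
    unfolding is_2_adesign_def using inc cardP size pairs m by auto
qed

end

section \<open>Parameters of a Paley type graph\<close>

text \<open>Walks of length two from a fixed vertex are counted by their middle vertex and by their
  end. The ends are the vertex itself, its \<open>k\<close> neighbours and its v - k - 1
  non-neighbours.\<close>

lemma srg_parameter_equation:
  assumes srg: "strongly_regular G v k l m" and "v > 0"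
  shows "k * k = k + k * l + (v - k - 1) * m"
proof -
  have G: "pair_graph G" and cardV: "card (pverts G) = v"
    and deg: "\<And>u. u \<in> pverts G \<Longrightarrow> card (neighbours G u) = k"
    and adj: "\<And>u w. (u, w) \<in> parcs G \<Longrightarrow> u \<in> pverts G \<Longrightarrow> w \<in> pverts G \<Longrightarrow>
      card (neighbours G u \<inter> neighbours G w) = l"
    and nonadj: "\<And>u w. u \<in> pverts G \<Longrightarrow> w \<in> pverts G \<Longrightarrow> u \<noteq> w \<Longrightarrow> (u, w) \<notin> parcs G \<Longrightarrow>
      card (neighbours G u \<inter> neighbours G w) = m"
    using srg unfolding strongly_regular_def by blast+
  interpret pair_graph G
    by (rule G)
  let ?N = "neighbours G"
  have sub: "?N u \<subseteq> pverts G" for u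
    unfolding neighbours_def using wellformed' by blast
  have finN: "finite (?N u)" for u
    using sub pair_finite_verts finite_subset by blast
  obtain x where x: "x \<in> pverts G"
    using cardV \<open>v > 0\<close> by fastforce
  have xN: "x \<notin> ?N x"
    unfolding neighbours_def using no_loops' by blast
  define M where "M = pverts G - insert x (?N x)"
  have cM: "card M = v - k - 1"
  proof -
    have "card (insert x (?N x)) = k + 1"
      using deg[OF x] xN finN by simp
    then show ?thesis
      unfolding M_def using sub x finN cardV by (simp add: card_Diff_subset)
  qed
  have "k * k = (\<Sum>p\<in>?N x. card {w \<in> pverts G. w \<in> ?N p})"
  proof -
    have "{w \<in> pverts G. w \<in> ?N p} = ?N p" for p
      using sub by blast
    then show ?thesis
      using deg x sub by (simp add: subset_iff)
  qed
  also have "\<dots> = (\<Sum>w\<in>pverts G. card {p \<in> ?N x. w \<in> ?N p})"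
    using sum.swap_restrict[OF finN pair_finite_verts, where g = "\<lambda>_ _. 1 :: nat" and R = "\<lambda>p w. w \<in> ?N p"]
    by simp
  also have "\<dots> = (\<Sum>w\<in>pverts G. card (?N x \<inter> ?N w))"
  proof (rule sum.cong[OF refl])
    fix w
    have "{p \<in> ?N x. w \<in> ?N p} = ?N x \<inter> ?N w"
      unfolding neighbours_def using arcs_symmetric by blast
    then show "card {p \<in> ?N x. w \<in> ?N p} = card (?N x \<inter> ?N w)"
      by simp
  qed
  also have "pverts G = insert x (?N x \<union> M)"
    unfolding M_def using sub x by blast
  also have "(\<Sum>w\<in>insert x (?N x \<union> M). card (?N x \<inter> ?N w))
      = k + (\<Sum>w\<in>?N x \<union> M. card (?N x \<inter> ?N w))"
    using xN finN pair_finite_verts deg[OF x] by (subst sum.insert) (auto simp: M_def)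
  also have "(\<Sum>w\<in>?N x \<union> M. card (?N x \<inter> ?N w))
      = (\<Sum>w\<in>?N x. card (?N x \<inter> ?N w)) + (\<Sum>w\<in>M. card (?N x \<inter> ?N w))"
    using finN pair_finite_verts by (intro sum.union_disjoint) (auto simp: M_def)
  also have "(\<Sum>w\<in>?N x. card (?N x \<inter> ?N w)) = (\<Sum>w\<in>?N x. l)"
    using adj x sub by (intro sum.cong) (auto simp: neighbours_def)
  also have "(\<Sum>w\<in>M. card (?N x \<inter> ?N w)) = (\<Sum>w\<in>M. m)"
    using nonadj x by (intro sum.cong) (auto simp: M_def neighbours_def)
  finally show ?thesis
    using deg[OF x] cM by simp
qed

text \<open>The Paley parameters are existentially bound, but the vertex count and the degree of one
  vertex determine \<open>v'\<close> and \<open>k'\<close>. Complementation replaces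
  \<open>k\<close> by v - 1 - k, which preserves being half of v - 1.\<close>

lemma paley_type_degree:
  assumes srg: "strongly_regular G v k l m" and "paley_type G" and "v > 0"
  shows "v = 2 * k + 1"
  using \<open>paley_type G\<close> unfolding paley_type_def
proof
  obtain x where x: "x \<in> pverts G"
    using srg \<open>v > 0\<close> unfolding strongly_regular_def by fastforce
  {
    assume "has_paley_parameters G"
    then obtain v' k' where "v' = card (pverts G)" "card (neighbours G x) = k'"
        "real k' = (real v' - 1) / 2"
      using x unfolding has_paley_parameters_def strongly_regular_def by blast
    then show ?thesis
      using srg x unfolding strongly_regular_def by auto
  next
    assume "has_paley_parameters (complement_graph G)"
    then obtain v' k' where *: "v' = card (pverts G)"
        "card (neighbours (complement_graph G) x) = k'" "real k' = (real v' - 1) / 2"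
      using x unfolding has_paley_parameters_def strongly_regular_def
      by (auto simp: complement_graph_def)
    interpret pair_graph G
      using srg unfolding strongly_regular_def by blast
    have "neighbours (complement_graph G) x = pverts G - insert x (neighbours G x)"
      using x by (auto simp: neighbours_def complement_graph_def)
    moreover have sub: "insert x (neighbours G x) \<subseteq> pverts G" and "x \<notin> neighbours G x"
      using x wellformed' no_loops' by (fastforce simp: neighbours_def)+
    moreover have "finite (neighbours G x)"
      using finite_subset[OF sub pair_finite_verts] by simp
    moreover have "card (insert x (neighbours G x)) \<le> card (pverts G)"
      by (rule card_mono[OF pair_finite_verts sub])
    ultimately have "k' + (k + 1) = v"
      using * srg x by (auto simp: card_Diff_subset strongly_regular_def)
    then show ?thesis
      using * srg unfolding strongly_regular_def by auto
  }
qed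

section \<open>Row supports of the adjacency matrix as a conference graph\<close>

lemma vec_support_adjacency_row:
  assumes "A = mat n n (\<lambda>(i, j). if (f i, f j) \<in> E then 1 else (0 :: 'b :: zero_neq_one))" "j < n"
  shows "vec_support (row A j) = {j'. j' < n \<and> (f j, f j') \<in> E}"
  using assms by (auto simp: vec_support_def split: if_splits)

lemma conference_graph_adjacency_rows:
  assumes srg: "strongly_regular G v k l (l + 1)" and "paley_type G" and "v > 0"
    and f: "bij_betw f {..<v} (pverts G)"
  shows "conference_graph {..<v} (\<lambda>j. {j'. j' < v \<and> (f j, f j') \<in> parcs G}) (l + 1)"
    and "k = 2 * (l + 1)"
proof -
  have v: "v = 2 * k + 1"
    using paley_type_degree assms by blast
  have "k > 0"
  proof (rule ccontr)
    assume "\<not> k > 0"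
    then have "v = 1" "k = 0"
      using v by auto
    \<comment> \<open>For a single vertex the parameter \<open>l'\<close> would be (1 - 5) / 4 = -1,
      impossible for a natural number.\<close>
    moreover from \<open>paley_type G\<close> have "\<exists>v' (l' :: nat). v' = card (pverts G) \<and> real l' = (real v' - 5) / 4"
      unfolding paley_type_def has_paley_parameters_def strongly_regular_def complement_graph_def
      by auto
    ultimately show False
      using srg unfolding strongly_regular_def by auto
  qed
  \<comment> \<open>With v - k - 1 = k the walk count reads k * k = k + k * l + k * (l + 1);
    cancelling \<open>k\<close> is where \<open>k > 0\<close> enters.\<close>
  have "k * k = k * (2 * (l + 1))"
    using srg_parameter_equation[OF srg \<open>v > 0\<close>] v by (simp add: algebra_simps)
  then show k: "k = 2 * (l + 1)"
    using \<open>k > 0\<close> mult_left_cancel[of k k "2 * (l + 1)"] by blast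
  let ?N = "\<lambda>j. {j'. j' < v \<and> (f j, f j') \<in> parcs G}"
  interpret pair_graph G
    using srg unfolding strongly_regular_def by blast
  have inj: "inj_on f {..<v}" and img: "f ` {..<v} = pverts G"
    using f by (auto simp: bij_betw_def)
  \<comment> \<open>The labelling \<open>f\<close> carries neighbourhoods of indices onto
    neighbourhoods in \<open>G\<close>, and by injectivity it preserves the sizes of their
    intersections.\<close>
  have nb: "neighbours G (f j) = f ` ?N j" for j
  proof (intro equalityI subsetI)
    fix w
    assume w: "w \<in> neighbours G (f j)"
    then have "w \<in> f ` {..<v}"
      unfolding img neighbours_def using wellformed' by blast
    then show "w \<in> f ` ?N j"
      using w unfolding neighbours_def by blast
  qed (auto simp: neighbours_def)
  have card_f: "card (f ` X) = card X" if "X \<subseteq> {..<v}" for X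
    using inj that by (metis card_image inj_on_subset)
  have cardN: "card (?N j) = card (neighbours G (f j))" for j
    unfolding nb by (rule card_f[symmetric]) auto
  have cardNN: "card (?N i \<inter> ?N j) = card (neighbours G (f i) \<inter> neighbours G (f j))" for i j
  proof -
    have "neighbours G (f i) \<inter> neighbours G (f j) = f ` (?N i \<inter> ?N j)"
      unfolding nb by (rule inj_on_image_Int[OF inj, symmetric]) auto
    moreover have "card (f ` (?N i \<inter> ?N j)) = card (?N i \<inter> ?N j)"
      by (rule card_f) blast
    ultimately show ?thesis
      by (simp only:)
  qed
  have fV: "j < v \<Longrightarrow> f j \<in> pverts G" for j
    using img by blast
  have f_inj: "i < v \<Longrightarrow> j < v \<Longrightarrow> f i = f j \<longleftrightarrow> i = j" for i j
    using inj by (auto simp: inj_on_def)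
  show "conference_graph {..<v} ?N (l + 1)"
  proof
    show "finite {..<v}" "card {..<v} = 4 * (l + 1) + 1"
      using v k by auto
  next
    fix x y
    assume "x \<in> {..<v}"
    then have x: "x < v"
      by simp
    show "?N x \<subseteq> {..<v}" "x \<notin> ?N x"
      using no_loops' by auto
    show "card (?N x) = 2 * (l + 1)"
      unfolding cardN using srg x k fV unfolding strongly_regular_def by blast
    {
      assume y: "y \<in> ?N x"
      then show "x \<in> ?N y"
        using x arcs_symmetric by blast
      show "card (?N x \<inter> ?N y) + 1 = l + 1"
        unfolding cardNN using srg x y fV unfolding strongly_regular_def by blast
    next
      assume "y \<in> {..<v}" "x \<noteq> y" "y \<notin> ?N x"
      then show "card (?N x \<inter> ?N y) = l + 1"
        unfolding cardNN using srg x fV f_inj unfolding strongly_regular_def by simp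
    }
  qed
qed

section \<open>The adesign of a matrix row\<close>

theorem theorem4:
  fixes G :: "'a pair_pre_digraph"
    and A :: "'b :: zero_neq_one mat"
    and v k l i :: nat
    and R :: "nat set"
    and Binf :: "nat option set set"
  assumes "strongly_regular G v k l (l + 1)"
    and "paley_type G"
    and "l \<ge> 2"
    and "is_adjacency_matrix G A"
    and "i < dim_row A"
    and "R = vec_support (row A i)"
    and "Binf = extended_blocks (row_intersections A R) l"
  shows "is_2_adesign (extended_points R) Binf (membership_incidence Binf)
           (k + 1) (l + 1) (l - 1)"
proof -
  have "card (pverts G) = v"
    using assms(1) unfolding strongly_regular_def by blast
  then obtain f where f: "bij_betw f {..<v} (pverts G)"
    and A: "A = mat v v (\<lambda>(i, j). if (f i, f j) \<in> parcs G then 1 else 0)"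
    using assms(4) unfolding is_adjacency_matrix_def by auto
  have dim: "dim_row A = v" and i: "i < v"
    using A assms(5) by auto
  define N where "N = (\<lambda>j. {j'. j' < v \<and> (f j, f j') \<in> parcs G})"
  have "v > 0"
    using i by simp
  note conf = conference_graph_adjacency_rows[OF assms(1,2) this f, folded N_def]
  interpret conference_graph "{..<v}" N "l + 1"
    by (rule conf)
  have row: "vec_support (row A j) = N j" if "j < v" for j
    using vec_support_adjacency_row[OF A that] unfolding N_def .
  have R: "R = N i"
    using row i assms(6) by simp
  \<comment> \<open>Equal neighbourhoods would intersect in 2 * (l + 1) elements, but distinct
    vertices share only \<open>l\<close> or \<open>l + 1\<close>. Hence the condition
    \<open>S \<noteq> R\<close> on supports discards exactly the index \<open>i\<close>.\<close>
  have ne: "N j \<noteq> N i" if "j < v" "j \<noteq> i" for j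
  proof
    assume "N j = N i"
    then have "2 * (l + 1) + 1 = l + 1 \<or> 2 * (l + 1) = l + 1"
      using card_N[of i] common_adj[of i j] common_nonadj[of i j] i that by auto
    then show False
      by simp
  qed
  have rows: "row_intersections A R = (\<lambda>j. N i \<inter> N j) ` ({..<v} - {i})"
  proof (intro equalityI subsetI)
    fix b
    assume "b \<in> row_intersections A R"
    then obtain j where "j < v" "b = N i \<inter> N j" "N j \<noteq> N i"
      unfolding row_intersections_def dim R using row by blast
    then show "b \<in> (\<lambda>j. N i \<inter> N j) ` ({..<v} - {i})"
      by blast
  next
    fix b
    assume "b \<in> (\<lambda>j. N i \<inter> N j) ` ({..<v} - {i})"
    then obtain j where j: "j < v" "j \<noteq> i" "b = N i \<inter> N j"
      by blast
    then have "N j = vec_support (row A j)" "N j \<noteq> R"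
      using row ne R by simp_all
    then show "b \<in> row_intersections A R"
      unfolding row_intersections_def dim using j R by blast
  qed
  have size: "card (N i \<inter> N j) = (if j \<in> N i then l else l + 1)" if "j < v" "j \<noteq> i" for j
    using common_adj[of i j] common_nonadj[of i j] i that by auto
  \<comment> \<open>By \<open>size\<close>, selecting traces by cardinality \<open>l\<close> or
    \<open>l + 1\<close> is selecting \<open>j\<close> by adjacency to \<open>i\<close>, as in
    \<open>ext_block\<close>.\<close>
  have "Binf = ext_block i ` ({..<v} - {i})"
  proof -
    have "Binf = {Some ` (N i \<inter> N j) | j. j \<in> {..<v} - {i} \<and> j \<notin> N i} \<union>
        {insert None (Some ` (N i \<inter> N j)) | j. j \<in> {..<v} - {i} \<and> j \<in> N i}"
    proof -
      have "{Some ` b | b. b \<in> row_intersections A R \<and> card b = l + 1}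
          = {Some ` (N i \<inter> N j) | j. j \<in> {..<v} - {i} \<and> card (N i \<inter> N j) = l + 1}"
        "{insert None (Some ` b) | b. b \<in> row_intersections A R \<and> card b = l}
          = {insert None (Some ` (N i \<inter> N j)) | j. j \<in> {..<v} - {i} \<and> card (N i \<inter> N j) = l}"
        unfolding rows by blast+
      moreover have "j \<in> {..<v} - {i} \<and> card (N i \<inter> N j) = l + 1
          \<longleftrightarrow> j \<in> {..<v} - {i} \<and> j \<notin> N i"
        "j \<in> {..<v} - {i} \<and> card (N i \<inter> N j) = l \<longleftrightarrow> j \<in> {..<v} - {i} \<and> j \<in> N i" for j
        using size[of j] by (auto split: if_splits)
      ultimately show ?thesis
        unfolding assms(7) extended_blocks_def by simp
    qed
    also have "\<dots> = ext_block i ` ({..<v} - {i})"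
    proof -
      have "Some ` (N i \<inter> N j) = ext_block i j" if "j \<notin> N i" for j
        using that unfolding ext_block_def by simp
      moreover have "insert None (Some ` (N i \<inter> N j)) = ext_block i j" if "j \<in> N i" for j
        using that unfolding ext_block_def by simp
      ultimately have
        "{Some ` (N i \<inter> N j) | j. j \<in> {..<v} - {i} \<and> j \<notin> N i}
          = ext_block i ` {j \<in> {..<v} - {i}. j \<notin> N i}"
        "{insert None (Some ` (N i \<inter> N j)) | j. j \<in> {..<v} - {i} \<and> j \<in> N i}
          = ext_block i ` {j \<in> {..<v} - {i}. j \<in> N i}"
        unfolding setcompr_eq_image by (auto intro!: image_cong)
      then show ?thesis
        by (simp only: image_Un[symmetric]) (rule arg_cong[where f = "image _"], blast)
    qed
    finally show ?thesis .
  qed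
  \<comment> \<open>With m = l + 1 and k = 2m, the parameters 2m + 1, m, m - 2 become k + 1, l + 1,
    l - 1, and \<open>l \<ge> 2\<close> supplies \<open>m \<ge> 3\<close>.\<close>
  then show ?thesis
    using is_2_adesign_ext_block[of i] i assms(3) conf(2) R
    unfolding extended_points_def by simp
qed

end
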